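(* Let $\mathbb{G}$ be a homogeneous group of homogeneous dimension $Q\geq 1$ and let $|\cdot|$ be an arbitrary homogeneous quasi-norm on $\mathbb{G}$. Let $\lambda>0$ and $p,q'\in(0,1)$ satisfy $$\frac{1}{q'}+\frac{1}{p}=\frac{\lambda}{Q}+2.$$ Then there is a constant $C>0$, independent of $f$ and $h$, such that for all non-negative functions $f\in L^{q'}(\mathbb{G})$ and $h\in L^{p}(\mathbb{G})$, $$\int_{\mathbb{G}}\int_{\mathbb{G}}|y^{-1}x|^{\lambda}f(x)h(y)\,dx\,dy\geq C\,\|f\|_{L^{q'}(\mathbb{G})}\|h\|_{L^{p}(\mathbb{G})}.$$
   Context: A homogeneous (Lie) group $\mathbb{G}$ is a Lie group on $\mathbb{R}^N$ equipped with dilations $D_\lambda(x)=(\lambda^{\nu_1}x_1,\ldots,\lambda^{\nu_N}x_N)$, $\nu_1,\ldots,\nu_N>0$, such that $D_\lambda$ is an automorphism of the group $\mathbb{G}$ for each $\lambda>0$; one writes $\lambda x$ for $D_\lambda(x)$. Its homogeneous dimension is $Q=\nu_1+\cdots+\nu_N$. A homogeneous quasi-norm on $\mathbb{G}$ is a continuous non-negative function $x\mapsto|x|\in[0,\infty)$ with $|x^{-1}|=|x|$ for all $x$, $|\lambda x|=\lambda|x|$ for all $x\in\mathbb{G}$ and $\lambda>0$, and $|x|=0$ if and only if $x=0$. Here $dx$ is the Haar measure on $\mathbb{G}$ (Lebesgue measure on $\mathbb{R}^N$), $y^{-1}x$ is the group product, and for $0<s<1$, $\|f\|_{L^s(\mathbb{G})}=\left(\int_{\mathbb{G}}|f(x)|^s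 dx\right)^{1/s}$. *)

theory Defs
  imports "HOL-Analysis.Analysis" "HOL-Algebra.Group"
begin

(* C_times k f: f is of class C^k; the derivative is differentiated further one direction at
   a time, which in finite dimension is the same as differentiating the full derivative. *)
primrec C_times :: "nat \<Rightarrow> ('a::euclidean_space \<Rightarrow> 'b::euclidean_space) \<Rightarrow> bool" where
  "C_times 0 f \<longleftrightarrow> continuous_on UNIV f"
| "C_times (Suc k) f \<longleftrightarrow>
     (\<forall>x. f differentiable (at x)) \<and> (\<forall>v. C_times k (\<lambda>x. frechet_derivative f (at x) v))"

definition smooth :: "('a::euclidean_space \<Rightarrow> 'b::euclidean_space) \<Rightarrow> bool" where
  "smooth f \<longleftrightarrow> (\<forall>k. C_times k f)"

locale euclidean_lie_group = group G
  for G :: "(real ^ 'n) monoid" (structure) +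
  assumes carrier_UNIV: "carrier G = UNIV"
    and smooth_mult: "smooth (\<lambda>(x, y). x \<otimes> y)"
    and smooth_inv: "smooth (\<lambda>x. inv x)"

definition dilation :: "('n \<Rightarrow> real) \<Rightarrow> real \<Rightarrow> real ^ 'n \<Rightarrow> real ^ 'n" where
  "dilation \<nu> r x = (\<chi> i. r powr \<nu> i * x $ i)"

definition homogeneous_dimension :: "('n::finite \<Rightarrow> real) \<Rightarrow> real" where
  "homogeneous_dimension \<nu> = (\<Sum>i\<in>UNIV. \<nu> i)"

(* The neutral element is not required to be the origin: it is a fixed point of every
   dilation, and 0 is the only such point. *)
locale homogeneous_group = euclidean_lie_group G
  for G :: "(real ^ 'n) monoid" (structure) and \<nu> :: "'n \<Rightarrow> real" +
  assumes weight_pos: "0 < \<nu> i"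
    and dilation_iso: "0 < r \<Longrightarrow> dilation \<nu> r \<in> iso G G"

locale homogeneous_quasi_norm = homogeneous_group G \<nu>
  for G :: "(real ^ 'n) monoid" (structure) and \<nu> :: "'n \<Rightarrow> real" +
  fixes qnorm :: "real ^ 'n \<Rightarrow> real"
  assumes qnorm_continuous: "continuous_on UNIV qnorm"
    and qnorm_nonneg: "0 \<le> qnorm x"
    and qnorm_inv: "qnorm (inv x) = qnorm x"
    and qnorm_dilation: "0 < r \<Longrightarrow> qnorm (dilation \<nu> r x) = r * qnorm x"
    and qnorm_eq_0_iff: "qnorm x = 0 \<longleftrightarrow> x = 0"

(* Haar measure on a homogeneous group is Lebesgue measure. *)
definition Lspace :: "real \<Rightarrow> (real ^ 'n \<Rightarrow> real) set" where
  "Lspace s = {f \<in> borel_measurable lebesgue. integrable lebesgue (\<lambda>x. \<bar>f x\<bar> powr s)}"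

(* Only a quasi-norm for 0 < s < 1. *)
definition Lnorm :: "real \<Rightarrow> (real ^ 'n \<Rightarrow> real) \<Rightarrow> real" where
  "Lnorm s f = (LINT x|lebesgue. \<bar>f x\<bar> powr s) powr (1 / s)"

end

(* Write N(y,x) = |y^{-1}x|, a = 1/q' - 1 and b = 1/p - 1, so that l/Q = a + b. Choose a height s
   such that min(f^q', s) carries exactly half of J = int f^q', and put m_f = J/(2s); define m_h
   in the same way from h and p. The set {f^q' > s} has measure at most m_f and carries the other
   half of J, so Hoelder gives int f >= c m_f^{-a} |f|_q'. On the other hand a quasi-ball of measure
   m_f/2 carries at most J/4 of the truncated mass, so it may be removed, and the reverse Hoelder
   inequality against N^l, whose relevant negative power is integrable away from the centre, gives
   int N(y,x)^l f(x) dx >= c m_f^b |f|_q' for every y. If m_h <= m_f, integrate this second bound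
   for f against the first bound for h: the powers leave (m_f/m_h)^b >= 1. If m_f <= m_h, exchange
   f and h by symmetry of N and Tonelli.

   The group only enters through the volume bound C R^Q for quasi-balls with arbitrary centre. By
   dilation it is enough to consider small quasi-balls with centres near the origin, where left
   translations are uniformly Lipschitz; exact invariance of Lebesgue measure is not needed. *)

theory Submission
  imports Defs
begin

section \<open>Hoelder's inequality and its reverse form for exponents below one\<close>

lemma powr_mult_powr_le:
  fixes a b t :: real
  assumes "0 < t" "t < 1" "0 \<le> a" "0 \<le> b"
  shows "a powr t * b powr (1 - t) \<le> t * a + (1 - t) * b"
proof (cases "a = 0 \<or> b = 0")
  case False
  then show ?thesis
    using Youngs_inequality_0[of t "1 - t" a b] assms by auto
qed (use assms in auto)

text \<open>Hoelder's inequality with upper bounds \<open>U\<close> and \<open>W\<close> in place of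
  the integrals: after normalising by these bounds, the weighted AM-GM inequality integrates to at
  most q + (1 - q) = 1.\<close>

lemma nn_integral_powr_mult_le:
  fixes u v :: "'a \<Rightarrow> real"
  assumes u: "u \<in> borel_measurable M" "\<And>x. 0 \<le> u x" and v: "v \<in> borel_measurable M" "\<And>x. 0 \<le> v x"
    and q: "0 < q" "q < 1" and U: "0 < U" "(\<integral>\<^sup>+ x. ennreal (u x) \<partial>M) \<le> ennreal U"
    and W: "0 < W" "(\<integral>\<^sup>+ x. ennreal (v x) \<partial>M) \<le> ennreal W"
  shows "(\<integral>\<^sup>+ x. ennreal (u x powr q * v x powr (1 - q)) \<partial>M) \<le> ennreal (U powr q * W powr (1 - q))"
proof -
  note [measurable] = u(1) v(1)
  let ?K = "U powr q * W powr (1 - q)"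
  have pt: "u x powr q * v x powr (1 - q) \<le> ?K * q / U * u x + ?K * (1 - q) / W * v x" for x
  proof -
    have "u x powr q * v x powr (1 - q) = ?K * ((u x / U) powr q * (v x / W) powr (1 - q))"
      using u(2) v(2) U W by (simp add: powr_divide)
    also have "\<dots> \<le> ?K * (q * (u x / U) + (1 - q) * (v x / W))"
      using u(2) v(2) U W q by (intro mult_left_mono powr_mult_powr_le) auto
    finally show ?thesis
      by (simp add: algebra_simps)
  qed
  have "(\<integral>\<^sup>+ x. ennreal (u x powr q * v x powr (1 - q)) \<partial>M)
      \<le> (\<integral>\<^sup>+ x. ennreal (?K * q / U) * ennreal (u x) + ennreal (?K * (1 - q) / W) * ennreal (v x) \<partial>M)"
    using pt u(2) v(2) U(1) W(1) q
    by (intro nn_integral_mono) (simp flip: ennreal_mult ennreal_plus)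
  also have "\<dots> = ennreal (?K * q / U) * (\<integral>\<^sup>+ x. ennreal (u x) \<partial>M)
      + ennreal (?K * (1 - q) / W) * (\<integral>\<^sup>+ x. ennreal (v x) \<partial>M)"
    by (simp add: nn_integral_add nn_integral_cmult)
  also have "\<dots> \<le> ennreal (?K * q / U) * ennreal U + ennreal (?K * (1 - q) / W) * ennreal W"
    by (intro add_mono mult_left_mono U W) auto
  also have "\<dots> = ennreal (?K * q / U * U + ?K * (1 - q) / W * W)"
    using U(1) W(1) q by (simp flip: ennreal_mult ennreal_plus)
  also have "?K * q / U * U + ?K * (1 - q) / W * W = ?K"
    using U(1) W(1) by (simp add: field_simps)
  finally show ?thesis .
qed

text \<open>Hoelder gives J \<le> (\<integral>u)^q W^(1 - q), and this is solved for the integral of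
  \<open>u\<close>.\<close>

lemma reverse_Holder:
  fixes u v :: "'a \<Rightarrow> real"
  assumes u: "u \<in> borel_measurable M" "\<And>x. 0 \<le> u x" and v: "v \<in> borel_measurable M" "\<And>x. 0 \<le> v x"
    and q: "0 < q" "q < 1" and J: "0 < J" "ennreal J \<le> (\<integral>\<^sup>+ x. ennreal (u x powr q * v x powr (1 - q)) \<partial>M)"
    and W: "0 < W" "(\<integral>\<^sup>+ x. ennreal (v x) \<partial>M) \<le> ennreal W"
  shows "ennreal (J powr (1 / q) * W powr (1 - 1 / q)) \<le> (\<integral>\<^sup>+ x. ennreal (u x) \<partial>M)"
proof (rule ccontr)
  let ?X = "J powr (1 / q) * W powr (1 - 1 / q)"
  assume "\<not> ?thesis"
  \<comment> \<open>A real number strictly above the integral serves as the bound \<open>U\<close>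
    in Hoelder's inequality: it is positive even when the integral is 0.\<close>
  then obtain z where z: "(\<integral>\<^sup>+ x. ennreal (u x) \<partial>M) < z" "z < ennreal ?X"
    using dense by (metis not_le)
  then obtain z' where z': "z = ennreal z'" "0 \<le> z'"
    by (cases z) auto
  have "z' < ?X" 
    using z z' by (auto simp: ennreal_less_iff)
  have "z' > 0"
    using z z' by (metis ennreal_0 le_less not_less_zero)
  have "ennreal J \<le> ennreal (z' powr q * W powr (1 - q))"
    using J(2) nn_integral_powr_mult_le[OF u v q \<open>z' > 0\<close> _ W] z(1) z'(1)
    by (meson less_imp_le order_trans)
  then have "J \<le> z' powr q * W powr (1 - q)"
    by (simp add: ennreal_le_iff)
  also have "\<dots> < ?X powr q * W powr (1 - q)"
    using \<open>z' < ?X\<close> \<open>z' > 0\<close> q W by (intro mult_strict_right_mono powr_less_mono2) auto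
  also have "\<dots> = J powr ((1 / q) * q) * W powr ((1 - 1 / q) * q + (1 - q))"
    using J W by (simp add: powr_mult powr_powr powr_add)
  also have "(1 - 1 / q) * q + (1 - q) = 0"
    using q by (simp add: field_simps)
  finally show False
    using J W q by simp
qed

section \<open>Splitting a function at the height of half its mass\<close>

text \<open>The mass of the truncation at height \<open>s\<close> depends continuously on
  \<open>s\<close> and runs from 0 towards the full integral, so the intermediate value theorem
  applies.\<close>

lemma truncation_level:
  fixes g :: "'a \<Rightarrow> real"
  assumes g: "integrable M g" "\<And>x. 0 \<le> g x" and J: "0 < (LINT x|M. g x)"
  obtains s where "0 < s" "(LINT x|M. min (g x) s) = (LINT x|M. g x) / 2"
proof -
  let ?J = "LINT x|M. g x"
  \<comment> \<open>With \<open>max 0 s\<close> the truncation stays between 0 and \<open>g\<close>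
    for every real \<open>s\<close>, so \<open>g\<close> dominates in both limits below.\<close>
  define K where "K s = (LINT x|M. min (g x) (max 0 s))" for s
  have gm[measurable]: "g \<in> borel_measurable M"
    using g by auto
  have cont: "continuous_on UNIV K"
    unfolding continuous_on_sequentially comp_def K_def
  proof safe
    fix s :: "nat \<Rightarrow> real" and a assume "s \<longlonglongrightarrow> a"
    then show "(\<lambda>n. LINT x|M. min (g x) (max 0 (s n))) \<longlonglongrightarrow> (LINT x|M. min (g x) (max 0 a))"
      by (intro integral_dominated_convergence[where w=g] AE_I2 tendsto_intros) (auto simp: g)
  qed
  have "(\<lambda>n. K (real n)) \<longlonglongrightarrow> ?J"
    unfolding K_def
  proof (intro integral_dominated_convergence[where w=g] AE_I2)
    fix x
    obtain m where "g x \<le> real m" using real_arch_simple by blast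
    then have "\<forall>\<^sub>F n in sequentially. min (g x) (max 0 (real n)) = g x"
      by (intro eventually_sequentiallyI[of m]) auto
    then show "(\<lambda>n. min (g x) (max 0 (real n))) \<longlonglongrightarrow> g x"
      by (rule tendsto_eventually)
  qed (auto simp: g)
  then have "\<forall>\<^sub>F n in sequentially. K (real n) > ?J / 2"
    by (rule order_tendstoD) (use J in auto)
  then obtain n where n: "K (real n) > ?J / 2"
    by (auto simp: eventually_sequentially)
  have K0: "K 0 = 0"
    unfolding K_def using g(2) by (simp add: min_absorb2)
  have "\<exists>s\<ge>0. s \<le> real n \<and> K s = ?J / 2"
    by (rule IVT') (use n J K0 cont continuous_on_subset in auto)
  then obtain s where s: "s \<ge> 0" "K s = ?J / 2" by auto
  moreover have "s \<noteq> 0" using K0 s J by auto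
  ultimately show ?thesis
    using that[of s] by (simp add: K_def)
qed

text \<open>The equal split leaves mass J/2 on both sides of \<open>s\<close>: the excess over
  \<open>s\<close> bounds \<integral>f from below, while the bounded part survives the removal of a
  small quasi-ball.\<close>

definition half_level :: "'a measure \<Rightarrow> real \<Rightarrow> ('a \<Rightarrow> real) \<Rightarrow> real \<Rightarrow> bool" where
  "half_level M q f s \<longleftrightarrow> f \<in> borel_measurable M \<and> (\<forall>x. 0 \<le> f x) \<and> integrable M (\<lambda>x. f x powr q) \<and>
     0 < (LINT x|M. f x powr q) \<and> 0 < s \<and>
     (LINT x|M. min (f x powr q) s) = (LINT x|M. f x powr q) / 2"

text \<open>An upper bound for the measure of the set where \<open>f powr q\<close> exceeds the level \<open>s\<close>.\<close>

definition half_width :: "'a measure \<Rightarrow> real \<Rightarrow> ('a \<Rightarrow> real) \<Rightarrow> real \<Rightarrow> real" where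
  "half_width M q f s = (LINT x|M. f x powr q) / (2 * s)"

lemma half_width_pos: "half_level M q f s \<Longrightarrow> 0 < half_width M q f s"
  by (simp add: half_level_def half_width_def)

lemma half_levelD:
  assumes "half_level M q f s"
  shows "f \<in> borel_measurable M" "0 \<le> f x" "integrable M (\<lambda>x. f x powr q)"
    "0 < (LINT x|M. f x powr q)" "0 < s"
    "(LINT x|M. min (f x powr q) s) = (LINT x|M. f x powr q) / 2"
  using assms by (auto simp: half_level_def)

lemma half_level_exists:
  assumes "f \<in> borel_measurable M" "\<And>x. 0 \<le> f x" "integrable M (\<lambda>x. f x powr q)"
    "0 < (LINT x|M. f x powr q)"
  obtains s where "half_level M q f s"
  using truncation_level[OF assms(3) _ assms(4)] assms by (auto simp: half_level_def)

lemma integrable_min_half_level: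
  assumes "half_level M q f s"
  shows "integrable M (\<lambda>x. min (f x powr q) s)"
  using half_levelD[OF assms]
  by (intro Bochner_Integration.integrable_bound[OF half_levelD(3)[OF assms]]) auto

text \<open>The excess of \<open>f powr q\<close> over \<open>s\<close> has mass J/2 and lives on
  \<open>A\<close>, so reverse Hoelder applies with the indicator of \<open>A\<close> as second
  factor.\<close>

lemma big_part_ge:
  assumes hl: "half_level M q f s" and q: "0 < q" "q < 1"
  shows "ennreal ((1 / 2) powr (1 / q) * half_width M q f s powr (1 - 1 / q) *
      (LINT x|M. f x powr q) powr (1 / q)) \<le> (\<integral>\<^sup>+ x. ennreal (f x) \<partial>M)"
proof -
  let ?J = "LINT x|M. f x powr q"
  note f = half_levelD[OF hl]
  note [measurable] = f(1)
  define A where "A = {x \<in> space M. s < f x powr q}"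
  have [measurable]: "A \<in> sets M" unfolding A_def by measurable
  note im = integrable_min_half_level[OF hl]
  define u v where "u x = f x * indicator A x" and "v = (indicator A :: _ \<Rightarrow> real)" for x
  \<comment> \<open>Chebyshev's inequality for the truncation, whose integral is J/2; this is the
    origin of the 2 in \<open>half_width\<close>.\<close>
  have "ennreal s * emeasure M A = (\<integral>\<^sup>+ x. ennreal s * indicator A x \<partial>M)"
    by (simp add: nn_integral_cmult_indicator)
  also have "\<dots> \<le> (\<integral>\<^sup>+ x. ennreal (min (f x powr q) s) \<partial>M)"
    by (intro nn_integral_mono) (auto simp: A_def indicator_def)
  also have "\<dots> = ennreal (?J / 2)"
    using f(5) by (subst nn_integral_eq_integral[OF im]) (auto simp: f(6))
  finally have "ennreal s * emeasure M A \<le> ennreal (?J / 2)" .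
  then have "ennreal (1 / s) * (ennreal s * emeasure M A) \<le> ennreal (1 / s) * ennreal (?J / 2)"
    by (rule mult_left_mono) simp
  then have mA: "emeasure M A \<le> ennreal (half_width M q f s)"
    using f(4,5) by (simp add: mult.assoc[symmetric] mult.commute half_width_def flip: ennreal_mult)
  have "?J / 2 = (LINT x|M. f x powr q - min (f x powr q) s)"
    using f(3,6) im by simp
  also have "ennreal \<dots> = (\<integral>\<^sup>+ x. ennreal (f x powr q - min (f x powr q) s) \<partial>M)"
    using f(3) im by (intro nn_integral_eq_integral[symmetric]) auto
  also have "\<dots> \<le> (\<integral>\<^sup>+ x. ennreal (u x powr q * v x powr (1 - q)) \<partial>M)"
    using f(5) by (intro nn_integral_mono) (auto simp: A_def indicator_def u_def v_def min_def not_le)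
  finally have "ennreal (?J / 2) \<le> (\<integral>\<^sup>+ x. ennreal (u x powr q * v x powr (1 - q)) \<partial>M)" .
  then have "ennreal ((?J / 2) powr (1 / q) * half_width M q f s powr (1 - 1 / q)) \<le> (\<integral>\<^sup>+ x. ennreal (u x) \<partial>M)"
    using f mA half_width_pos[OF hl] q
    by (intro reverse_Holder[where v=v]) (auto simp: u_def v_def ennreal_indicator)
  also have "\<dots> \<le> (\<integral>\<^sup>+ x. ennreal (f x) \<partial>M)"
    using f(2) by (intro nn_integral_mono) (auto simp: u_def indicator_def)
  finally show ?thesis
    using f(4) by (simp add: powr_divide mult_ac)
qed

section \<open>Kernels with polynomial volume growth\<close>

text \<open>The kernel |y^(-1) x| in abstract form. The constant in \<open>ball_le\<close> is the
  same for every centre, which makes the later lower bounds uniform in \<open>y\<close>.\<close>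

locale volume_growth = sigma_finite_measure M for M :: "'a measure" +
  fixes N :: "'a \<Rightarrow> 'a \<Rightarrow> real" and V Q :: real
  assumes N_nonneg: "0 \<le> N x y"
    and N_sym: "N x y = N y x"
    and N_measurable[measurable]: "(\<lambda>(x, y). N x y) \<in> borel_measurable (M \<Otimes>\<^sub>M M)"
    and V_pos: "0 < V" and Q_pos: "0 < Q"
    and ball_le: "y \<in> space M \<Longrightarrow> 0 < R \<Longrightarrow> emeasure M {x \<in> space M. N y x < R} \<le> ennreal (V * R powr Q)"
begin

lemma N_measurable1: "y \<in> space M \<Longrightarrow> N y \<in> borel_measurable M"
  using measurable_Pair2[OF N_measurable, of y] by simp

text \<open>The sum over k of V 2^Q 2^((Q - \<gamma>) k), the series produced by the dyadic shells
  in \<open>tail_le\<close>.\<close>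

definition tail_const :: "real \<Rightarrow> real" where
  "tail_const \<gamma> = V * 2 powr Q / (1 - 2 powr (Q - \<gamma>))"

lemma tail_const_pos: "Q < \<gamma> \<Longrightarrow> 0 < tail_const \<gamma>"
  unfolding tail_const_def using V_pos by (simp add: powr_less_one)

text \<open>The region is cut into dyadic shells around \<open>y\<close>. On the k-th shell the
  integrand is at most (2^k R)^(-\<gamma>), and the shell lies in a quasi-ball of radius 2^(k+1) R;
  the geometric series converges because \<gamma> > Q.\<close>

lemma tail_le:
  assumes y: "y \<in> space M" and R: "0 < R" and \<gamma>: "Q < \<gamma>"
  shows "(\<integral>\<^sup>+ x. ennreal (if R \<le> N y x then N y x powr - \<gamma> else 0) \<partial>M)
    \<le> ennreal (tail_const \<gamma> * R powr (Q - \<gamma>))"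
proof -
  note [measurable] = N_measurable1[OF y]
  let ?B = "\<lambda>k::nat. {x \<in> space M. N y x < 2 ^ Suc k * R}"
  have pt: "ennreal (if R \<le> N y x then N y x powr - \<gamma> else 0)
      \<le> (\<Sum>k. ennreal ((2 ^ k * R) powr - \<gamma>) * indicator (?B k) x)" if x: "x \<in> space M" for x
  proof (cases "R \<le> N y x")
    case True
    obtain n where n: "N y x / R < 2 ^ n"
      using real_arch_pow[of 2 "N y x / R"] by auto
    \<comment> \<open>The least such exponent is nonzero since \<open>R \<le> N y x\<close>; its
      predecessor is the index of the shell containing \<open>x\<close>.\<close>
    define n0 where "n0 = (LEAST n. N y x / R < 2 ^ n)"
    have n0: "N y x / R < 2 ^ n0"
      unfolding n0_def using n by (rule LeastI)
    have "n0 \<noteq> 0"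
    proof
      assume "n0 = 0"
      with n0 True R show False by simp
    qed
    then obtain k where k: "n0 = Suc k" by (cases n0) auto
    then have "\<not> N y x / R < 2 ^ k"
      using not_less_Least[of k "\<lambda>n. N y x / R < 2 ^ n"] by (simp add: n0_def)
    then have lo: "2 ^ k * R \<le> N y x" and hi: "N y x < 2 ^ Suc k * R"
      using n0 k R by (auto simp: field_simps)
    have "ennreal (N y x powr - \<gamma>) \<le> ennreal ((2 ^ k * R) powr - \<gamma>) * indicator (?B k) x"
      using lo hi x R \<gamma> Q_pos by (simp add: powr_mono2' ennreal_leI)
    also have "\<dots> \<le> (\<Sum>k. ennreal ((2 ^ k * R) powr - \<gamma>) * indicator (?B k) x)"
    proof -
      define F where "F k = ennreal ((2 ^ k * R) powr - \<gamma>) * indicator (?B k) x" for k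
      have "sum F {k} \<le> suminf F" by (rule sum_le_suminf) auto
      then have "F k \<le> suminf F" by simp
      then show ?thesis unfolding F_def .
    qed
    finally show ?thesis using True by simp
  qed simp
  have term_eq: "(2 ^ k * R) powr - \<gamma> * (V * (2 ^ Suc k * R) powr Q)
      = V * 2 powr Q * R powr (Q - \<gamma>) * (2 powr (Q - \<gamma>)) ^ k" for k
  proof -
    have p: "(2::real) ^ k = 2 powr k" by (simp add: powr_realpow)
    have "(2 powr (Q - \<gamma>)) ^ k = 2 powr ((Q - \<gamma>) * k)"
      by (simp add: powr_powr flip: powr_realpow)
    then show ?thesis
      unfolding power_Suc p using R
      by (simp add: powr_mult powr_powr powr_diff powr_minus field_simps left_diff_distrib)
  qed
  have r: "2 powr (Q - \<gamma>) < (1::real)" using \<gamma> by (simp add: powr_less_one)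
  have "(\<integral>\<^sup>+ x. ennreal (if R \<le> N y x then N y x powr - \<gamma> else 0) \<partial>M)
      \<le> (\<integral>\<^sup>+ x. (\<Sum>k. ennreal ((2 ^ k * R) powr - \<gamma>) * indicator (?B k) x) \<partial>M)"
    by (intro nn_integral_mono pt)
  also have "\<dots> = (\<Sum>k. ennreal ((2 ^ k * R) powr - \<gamma>) * emeasure M (?B k))"
    by (subst nn_integral_suminf) (simp_all add: nn_integral_cmult_indicator)
  also have "\<dots> \<le> (\<Sum>k. ennreal (V * 2 powr Q * R powr (Q - \<gamma>) * (2 powr (Q - \<gamma>)) ^ k))"
  proof (intro suminf_le)
    fix k
    have "ennreal ((2 ^ k * R) powr - \<gamma>) * emeasure M (?B k)
        \<le> ennreal ((2 ^ k * R) powr - \<gamma>) * ennreal (V * (2 ^ Suc k * R) powr Q)"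
      using R by (intro mult_left_mono ball_le y) auto
    also have "\<dots> = ennreal (V * 2 powr Q * R powr (Q - \<gamma>) * (2 powr (Q - \<gamma>)) ^ k)"
      using V_pos by (subst ennreal_mult[symmetric]) (simp_all only: term_eq powr_ge_zero mult_nonneg_nonneg less_imp_le)
    finally show "ennreal ((2 ^ k * R) powr - \<gamma>) * emeasure M (?B k) \<le> \<dots>" .
  qed auto
  also have "\<dots> = ennreal (\<Sum>k. V * 2 powr Q * R powr (Q - \<gamma>) * (2 powr (Q - \<gamma>)) ^ k)"
    using r V_pos by (intro suminf_ennreal2) (auto intro!: summable_mult summable_geometric)
  also have "(\<Sum>k. V * 2 powr Q * R powr (Q - \<gamma>) * (2 powr (Q - \<gamma>)) ^ k) = tail_const \<gamma> * R powr (Q - \<gamma>)"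
    using r by (subst suminf_mult) (auto simp: suminf_geometric summable_geometric tail_const_def)
  finally show ?thesis .
qed

text \<open>The factors come from the remaining mass J/4, from the tail integral with exponent l /
  (1/q - 1), and from the radius of the removed quasi-ball.\<close>

definition small_const :: "real \<Rightarrow> real \<Rightarrow> real" where
  "small_const l q = (1 / 4) powr (1 / q) * tail_const (l / (1 / q - 1)) powr (1 - 1 / q) *
     (1 / (2 * V)) powr (l / Q - (1 / q - 1))"

text \<open>The truncated function is at most \<open>s\<close>, so a quasi-ball of measure at most
  m/2 holds mass at most s m / 2 = J/4. Outside it, reverse Hoelder pairs
  \<open>N y x powr l * f x\<close> with an integrable negative power of \<open>N\<close>.\<close>

lemma small_part_ge:
  assumes hl: "half_level M q f s" and q: "0 < q" "q < 1" and l: "1 / q - 1 < l / Q"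
    and y: "y \<in> space M"
  shows "ennreal (small_const l q * half_width M q f s powr (l / Q - (1 / q - 1)) *
      (LINT x|M. f x powr q) powr (1 / q)) \<le> (\<integral>\<^sup>+ x. ennreal (N y x powr l * f x) \<partial>M)"
proof -
  let ?J = "LINT x|M. f x powr q"
  define a where "a = 1 / q - 1"
  define m where "m = half_width M q f s"
  \<comment> \<open>quasi-balls of radius \<open>R\<close> have measure at most \<open>m / 2\<close>\<close>
  define R where "R = (m / (2 * V)) powr (1 / Q)"
  \<comment> \<open>This choice gives \<gamma> (1 - q) = l q, so the powers of \<open>N\<close>
    cancel in the Hoelder product; the hypothesis on \<open>l\<close> says exactly that \<gamma> >
    Q.\<close>
  define \<gamma> where "\<gamma> = l / a"
  note f = half_levelD[OF hl]
  note [measurable] = f(1) N_measurable1[OF y]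
  note im = integrable_min_half_level[OF hl]
  have m: "0 < m" unfolding m_def by (rule half_width_pos[OF hl])
  have a: "0 < a" using q by (simp add: a_def)
  have \<gamma>: "Q < \<gamma>" using l a Q_pos by (simp add: \<gamma>_def a_def[symmetric] field_simps)
  have R: "0 < R" using m V_pos by (simp add: R_def)
  have RQ: "V * R powr Q = m / 2"
    using m V_pos Q_pos by (simp add: R_def powr_powr)
  define D where "D = {x \<in> space M. N y x < R}"
  have [measurable]: "D \<in> sets M" unfolding D_def by measurable
  define u v where "u x = (if R \<le> N y x then N y x powr l * f x else 0)"
    and "v x = (if R \<le> N y x then N y x powr - \<gamma> else 0)" for x
  have [measurable]: "u \<in> borel_measurable M" "v \<in> borel_measurable M"
    unfolding u_def[abs_def] v_def[abs_def] by measurable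
  have uv: "0 \<le> u x" "0 \<le> v x" for x
    using f(2) by (simp_all add: u_def v_def)
  have ball: "(\<integral>\<^sup>+ x. ennreal (min (f x powr q) s) * indicator D x \<partial>M) \<le> ennreal (?J / 4)"
  proof -
    have "(\<integral>\<^sup>+ x. ennreal (min (f x powr q) s) * indicator D x \<partial>M) \<le> (\<integral>\<^sup>+ x. ennreal s * indicator D x \<partial>M)"
      by (intro nn_integral_mono mult_right_mono) (auto intro!: ennreal_leI)
    also have "\<dots> = ennreal s * emeasure M D"
      by (simp add: nn_integral_cmult_indicator)
    also have "\<dots> \<le> ennreal s * ennreal (m / 2)"
      unfolding D_def RQ[symmetric] by (intro mult_left_mono ball_le y R) simp
    also have "\<dots> = ennreal (?J / 4)"
      using f(4,5) by (simp add: m_def half_width_def flip: ennreal_mult')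
    finally show ?thesis .
  qed
  \<comment> \<open>Of the truncated mass J/2 at most J/4 lies in \<open>D\<close>; cancelling this
    finite amount leaves at least J/4 outside.\<close>
  have "ennreal (?J / 4) + ennreal (?J / 4) = ennreal (?J / 2)"
    using f(4) by (simp flip: ennreal_plus)
  also have "\<dots> = (\<integral>\<^sup>+ x. ennreal (min (f x powr q) s) \<partial>M)"
    using f(5) by (subst nn_integral_eq_integral[OF im]) (auto simp: f(6))
  also have "\<dots> = (\<integral>\<^sup>+ x. ennreal (min (f x powr q) s) * indicator D x
        + ennreal (min (f x powr q) s) * indicator (space M - D) x \<partial>M)"
    by (intro nn_integral_cong) (auto simp: indicator_def)
  also have "\<dots> = (\<integral>\<^sup>+ x. ennreal (min (f x powr q) s) * indicator D x \<partial>M)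
        + (\<integral>\<^sup>+ x. ennreal (min (f x powr q) s) * indicator (space M - D) x \<partial>M)"
    by (intro nn_integral_add) auto
  also have "\<dots> \<le> ennreal (?J / 4) + (\<integral>\<^sup>+ x. ennreal (min (f x powr q) s) * indicator (space M - D) x \<partial>M)"
    by (intro add_mono ball) auto
  finally have "ennreal (?J / 4) \<le> (\<integral>\<^sup>+ x. ennreal (min (f x powr q) s) * indicator (space M - D) x \<partial>M)"
    by simp
  also have "\<dots> \<le> (\<integral>\<^sup>+ x. ennreal (u x powr q * v x powr (1 - q)) \<partial>M)"
  proof (intro nn_integral_mono)
    fix x assume x: "x \<in> space M"
    show "ennreal (min (f x powr q) s) * indicator (space M - D) x \<le> ennreal (u x powr q * v x powr (1 - q))"
    proof (cases "R \<le> N y x")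
      case True
      then have "u x powr q * v x powr (1 - q) = f x powr q * N y x powr (l * q - \<gamma> * (1 - q))"
        using R f(2)[of x] powr_add[of "N y x" "l * q" "- (\<gamma> * (1 - q))"]
        by (simp add: u_def v_def powr_mult powr_powr)
      also have "\<gamma> * (1 - q) = l * q"
        using q by (simp add: \<gamma>_def a_def field_simps)
      finally show ?thesis
        using True x R by (auto simp: D_def indicator_def intro!: ennreal_leI)
    qed (use x in \<open>auto simp: D_def indicator_def\<close>)
  qed
  finally have "ennreal ((?J / 4) powr (1 / q) * (tail_const \<gamma> * R powr (Q - \<gamma>)) powr (1 - 1 / q))
      \<le> (\<integral>\<^sup>+ x. ennreal (u x) \<partial>M)"
    using uv q f(4) tail_const_pos[OF \<gamma>] R tail_le[OF y R \<gamma>, folded v_def]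
    by (intro reverse_Holder[where v=v]) auto
  also have "(?J / 4) powr (1 / q) * (tail_const \<gamma> * R powr (Q - \<gamma>)) powr (1 - 1 / q)
      = small_const l q * m powr (l / Q - a) * ?J powr (1 / q)"
  proof -
    have "(tail_const \<gamma> * R powr (Q - \<gamma>)) powr (1 - 1 / q)
        = tail_const \<gamma> powr (1 - 1 / q) * (m / (2 * V)) powr ((1 / Q) * ((Q - \<gamma>) * (- a)))"
      using tail_const_pos[OF \<gamma>] R by (simp add: powr_mult powr_powr R_def a_def)
    \<comment> \<open>\<open>R\<close> is proportional to m^(1/Q), so R^(Q - \<gamma>) raised to the
      power 1 - 1/q = -a contributes m^(l/Q - a).\<close>
    also have "(1 / Q) * ((Q - \<gamma>) * (- a)) = l / Q - a"
      using Q_pos a by (simp add: \<gamma>_def field_simps)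
    finally show ?thesis
      using m V_pos f(4) unfolding small_const_def \<gamma>_def a_def
      by (simp add: powr_divide powr_mult)
  qed
  also have "(\<integral>\<^sup>+ x. ennreal (u x) \<partial>M) \<le> (\<integral>\<^sup>+ x. ennreal (N y x powr l * f x) \<partial>M)"
    using f(2) by (intro nn_integral_mono) (auto simp: u_def)
  finally show ?thesis
    by (simp add: m_def a_def)
qed

lemma small_const_pos:
  assumes "0 < q" "q < 1" "1 / q - 1 < l / Q"
  shows "0 < small_const l q"
proof -
  have "Q < l / (1 / q - 1)"
    using assms Q_pos by (simp add: field_simps)
  then show ?thesis
    using tail_const_pos V_pos by (fastforce simp: small_const_def)
qed

section \<open>The bilinear inequality for kernels with volume growth\<close>

definition rHLS_const :: "real \<Rightarrow> real \<Rightarrow> real \<Rightarrow> real" where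
  "rHLS_const l q p = small_const l q * (1 / 2) powr (1 / p)"

text \<open>The lower bound for the inner integral is uniform in \<open>y\<close>, so it can be
  integrated against \<open>h\<close>. The widths then enter only through (m/n)^b, which is at least
  1 by the ordering.\<close>

lemma reverse_HLS_ordered:
  assumes f: "half_level M q f s" and h: "half_level M p h t"
    and le: "half_width M p h t \<le> half_width M q f s"
    and q: "0 < q" "q < 1" and p: "0 < p" "p < 1" and pq: "1 / q + 1 / p = l / Q + 2"
  shows "ennreal (rHLS_const l q p * (LINT x|M. f x powr q) powr (1 / q) * (LINT x|M. h x powr p) powr (1 / p))
    \<le> (\<integral>\<^sup>+ y. (\<integral>\<^sup>+ x. ennreal (N y x powr l * f x * h y) \<partial>M) \<partial>M)"
proof -
  let ?J = "(LINT x|M. f x powr q) powr (1 / q)" and ?I = "(LINT x|M. h x powr p) powr (1 / p)"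
  let ?m = "half_width M q f s" and ?n = "half_width M p h t"
  define b where "b = 1 / p - 1"
  have b: "0 < b" using p by (simp add: b_def)
  \<comment> \<open>The relation between the exponents says that l/Q is the sum of 1/q - 1 and
    \<open>b\<close>; hence the width of \<open>f\<close> enters with power b and that of
    \<open>h\<close> with power -b.\<close>
  have lb: "l / Q - (1 / q - 1) = b" using pq by (simp add: b_def)
  then have lq: "1 / q - 1 < l / Q" using b by simp
  have mn: "0 < ?m" "0 < ?n" using f h by (auto intro: half_width_pos)
  note fD = half_levelD[OF f] and hD = half_levelD[OF h]
  note [measurable] = fD(1) hD(1)
  have c: "0 < small_const l q" using small_const_pos[OF q lq] .
  have "1 \<le> ?m powr b * ?n powr (1 - 1 / p)"
  proof -
    have "?m powr b * ?n powr (1 - 1 / p) = (?m / ?n) powr b"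
      using mn by (simp add: b_def powr_divide powr_diff field_simps)
    then show ?thesis using le mn b by (simp add: ge_one_powr_ge_zero)
  qed
  then have "rHLS_const l q p * ?J * ?I * 1 \<le> rHLS_const l q p * ?J * ?I * (?m powr b * ?n powr (1 - 1 / p))"
    using c by (intro mult_left_mono) (auto simp: rHLS_const_def)
  then have "ennreal (rHLS_const l q p * ?J * ?I)
      \<le> ennreal ((small_const l q * ?m powr b * ?J) * ((1 / 2) powr (1 / p) * ?n powr (1 - 1 / p) * ?I))"
    by (intro ennreal_leI) (simp add: rHLS_const_def mult_ac)
  also have "\<dots> = ennreal (small_const l q * ?m powr b * ?J)
      * ennreal ((1 / 2) powr (1 / p) * ?n powr (1 - 1 / p) * ?I)"
    using c by (intro ennreal_mult) auto
  also have "\<dots> \<le> ennreal (small_const l q * ?m powr b * ?J) * (\<integral>\<^sup>+ y. ennreal (h y) \<partial>M)"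
    by (intro mult_left_mono big_part_ge[OF h p]) simp
  also have "\<dots> = (\<integral>\<^sup>+ y. ennreal (small_const l q * ?m powr b * ?J) * ennreal (h y) \<partial>M)"
    by (simp add: nn_integral_cmult)
  also have "\<dots> \<le> (\<integral>\<^sup>+ y. (\<integral>\<^sup>+ x. ennreal (N y x powr l * f x) \<partial>M) * ennreal (h y) \<partial>M)"
    using small_part_ge[OF f q lq] by (intro nn_integral_mono mult_right_mono) (auto simp: lb)
  also have "\<dots> = (\<integral>\<^sup>+ y. (\<integral>\<^sup>+ x. ennreal (N y x powr l * f x * h y) \<partial>M) \<partial>M)"
  proof (intro nn_integral_cong)
    fix y assume y: "y \<in> space M"
    note [measurable] = N_measurable1[OF y]
    show "(\<integral>\<^sup>+ x. ennreal (N y x powr l * f x) \<partial>M) * ennreal (h y)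
        = (\<integral>\<^sup>+ x. ennreal (N y x powr l * f x * h y) \<partial>M)"
      using fD(2) hD(2) by (subst nn_integral_multc[symmetric]) (auto simp: ennreal_mult)
  qed
  finally show ?thesis .
qed

text \<open>One of the two widths is the larger one; symmetry of \<open>N\<close> and Tonelli allow
  \<open>f\<close> and \<open>h\<close> to be exchanged.\<close>

theorem reverse_HLS:
  assumes q: "0 < q" "q < 1" and p: "0 < p" "p < 1" and pq: "1 / q + 1 / p = l / Q + 2"
  shows "\<exists>C>0. \<forall>f h. f \<in> borel_measurable M \<longrightarrow> h \<in> borel_measurable M \<longrightarrow>
    (\<forall>x. 0 \<le> f x) \<longrightarrow> (\<forall>x. 0 \<le> h x) \<longrightarrow>
    integrable M (\<lambda>x. f x powr q) \<longrightarrow> integrable M (\<lambda>x. h x powr p) \<longrightarrow>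
    ennreal (C * (LINT x|M. f x powr q) powr (1 / q) * (LINT x|M. h x powr p) powr (1 / p))
      \<le> (\<integral>\<^sup>+ y. (\<integral>\<^sup>+ x. ennreal (N y x powr l * f x * h y) \<partial>M) \<partial>M)"
proof -
  \<comment> \<open>One constant for each ordering of the widths.\<close>
  define C where "C = min (rHLS_const l q p) (rHLS_const l p q)"
  have "1 < 1 / q" "1 < 1 / p"
    using p q by simp_all
  with pq have "1 / q - 1 < l / Q" "1 / p - 1 < l / Q"
    by linarith+
  then have C: "0 < C"
    using small_const_pos[of q l] small_const_pos[of p l] p q by (simp add: C_def rHLS_const_def)
  show ?thesis
  proof (intro exI[of _ C] conjI allI impI C)
    fix f h :: "'a \<Rightarrow> real"
    assume [measurable]: "f \<in> borel_measurable M" "h \<in> borel_measurable M"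
      and nn: "\<forall>x. 0 \<le> f x" "\<forall>x. 0 \<le> h x"
      and int: "integrable M (\<lambda>x. f x powr q)" "integrable M (\<lambda>x. h x powr p)"
    let ?J = "LINT x|M. f x powr q" and ?I = "LINT x|M. h x powr p"
    let ?rhs = "\<integral>\<^sup>+ y. (\<integral>\<^sup>+ x. ennreal (N y x powr l * f x * h y) \<partial>M) \<partial>M"
    have JI: "0 \<le> ?J" "0 \<le> ?I" by simp_all
    show "ennreal (C * ?J powr (1 / q) * ?I powr (1 / p)) \<le> ?rhs"
    \<comment> \<open>If one of the integrals vanishes, the left side is 0; otherwise both functions
      have a half level.\<close>
    proof (cases "?J = 0 \<or> ?I = 0")
      case False
      then obtain s t where s: "half_level M q f s" and t: "half_level M p h t"
        using half_level_exists[of f M q] half_level_exists[of h M p] nn int JI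
        by (metis \<open>f \<in> borel_measurable M\<close> \<open>h \<in> borel_measurable M\<close> order_less_le)
      show ?thesis
      proof (cases "half_width M p h t \<le> half_width M q f s")
        case True
        have "ennreal (C * ?J powr (1 / q) * ?I powr (1 / p))
            \<le> ennreal (rHLS_const l q p * ?J powr (1 / q) * ?I powr (1 / p))"
          by (intro ennreal_leI mult_right_mono) (auto simp: C_def)
        also have "\<dots> \<le> ?rhs"
          by (rule reverse_HLS_ordered[OF s t True q p pq])
        finally show ?thesis .
      next
        case False
        interpret pair_sigma_finite M M ..
        have "ennreal (C * ?J powr (1 / q) * ?I powr (1 / p))
            \<le> ennreal (rHLS_const l p q * ?I powr (1 / p) * ?J powr (1 / q))"
          by (subst mult.assoc, subst mult.commute[of "?J powr _"], subst mult.assoc[symmetric])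
            (intro ennreal_leI mult_right_mono, auto simp: C_def)
        also have "\<dots> \<le> (\<integral>\<^sup>+ x. (\<integral>\<^sup>+ y. ennreal (N x y powr l * h y * f x) \<partial>M) \<partial>M)"
          using False pq by (intro reverse_HLS_ordered[OF t s _ p q]) auto
        also have "\<dots> = (\<integral>\<^sup>+ x. (\<integral>\<^sup>+ y. ennreal (N x y powr l * f x * h y) \<partial>M) \<partial>M)"
          by (simp add: mult_ac)
        also have "\<dots> = (\<integral>\<^sup>+ y. (\<integral>\<^sup>+ x. ennreal (N x y powr l * f x * h y) \<partial>M) \<partial>M)"
          by (rule Fubini'[symmetric]) measurable
        also have "\<dots> = ?rhs"
          by (simp only: N_sym[of _ y for y])
        finally show ?thesis .
      qed
    qed auto
  qed
qed

end

section \<open>Lipschitz maps and dilations\<close>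

text \<open>No measurability of \<open>T\<close> is required, because \<open>emeasure\<close> is 0 on non-measurable sets.\<close>

lemma emeasure_subset_Lipschitz_image_le:
  fixes f :: "'a::euclidean_space \<Rightarrow> 'a"
  assumes S: "open S" and L: "0 < L"
    and lip: "\<And>x y. x \<in> S \<Longrightarrow> y \<in> S \<Longrightarrow> dist (f x) (f y) \<le> L * dist x y"
    and T: "T \<subseteq> f ` S"
  shows "emeasure lborel T \<le> ennreal ((5 * L) ^ DIM('a)) * emeasure lborel S"
proof -
  \<comment> \<open>Vitali covering yields disjoint balls inside \<open>S\<close> whose fivefold
    enlargements cover \<open>S\<close>. The part of \<open>S\<close> in an enlarged ball is mapped
    into a ball of radius 5 L r, and these balls cover \<open>T\<close>. Radii are capped at 1
    because the covering lemma asks for bounded radii.\<close>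
  have "\<exists>r. 0 < r \<and> r \<le> 1 \<and> ball x r \<subseteq> S" if x: "x \<in> S" for x
  proof -
    obtain e where "0 < e" "ball x e \<subseteq> S"
      using S x openE by blast
    then show ?thesis
      by (intro exI[of _ "min e 1"]) auto
  qed
  then obtain r where r: "\<And>x. x \<in> S \<Longrightarrow> 0 < r x \<and> r x \<le> 1 \<and> ball x (r x) \<subseteq> S"
    by metis
  obtain C where C: "countable C" "C \<subseteq> S"
    and disj: "pairwise (\<lambda>i j. disjnt (ball i (r i)) (ball j (r j))) C"
    and cov: "S \<subseteq> (\<Union>i\<in>C. ball i (5 * r i))"
    by (rule Vitali_covering_lemma_balls[where S=S and K=S and a="\<lambda>x. x" and r=r and B=1]) (use r in force)+
  define A where "A n = (if n \<in> to_nat_on C ` C then ball (from_nat_into C n) (r (from_nat_into C n)) else {})" for n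
  define B where "B n = (if n \<in> to_nat_on C ` C then ball (f (from_nat_into C n)) (5 * L * r (from_nat_into C n)) else {})" for n
  have T_sub: "T \<subseteq> (\<Union>n. B n)"
  proof
    fix t assume "t \<in> T"
    then obtain x where x: "x \<in> S" "t = f x" using T by auto
    then obtain i where i: "i \<in> C" "dist i x < 5 * r i" using cov by auto
    have "dist (f i) t \<le> L * dist i x" using lip i x C by auto
    also have "\<dots> < L * (5 * r i)" using i L by simp
    finally have "t \<in> B (to_nat_on C i)"
      using i C by (simp add: B_def)
    then show "t \<in> (\<Union>n. B n)" by blast
  qed
  have BA: "emeasure lborel (B n) = ennreal ((5 * L) ^ DIM('a)) * emeasure lborel (A n)" for n
  proof (cases "n \<in> to_nat_on C ` C")
    case True
    then obtain i where "i \<in> C" "n = to_nat_on C i" by auto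
    then show ?thesis
      using C r[of i] L
      by (auto simp: A_def B_def emeasure_ball power_mult_distrib mult_ac simp flip: ennreal_mult)
  qed (simp add: A_def B_def)
  have "disjoint_family A"
    unfolding disjoint_family_on_def
  proof (intro ballI impI)
    fix m n :: nat assume "m \<noteq> n"
    then show "A m \<inter> A n = {}"
      using disj C(1) by (auto simp: A_def pairwise_def disjnt_iff)
  qed
  then have sumA: "(\<Sum>n. emeasure lborel (A n)) = emeasure lborel (\<Union>n. A n)"
    by (intro suminf_emeasure) (auto simp: A_def[abs_def])
  have "(\<Union>n. A n) \<subseteq> S"
    using r C by (fastforce simp: A_def split: if_splits)
  have "emeasure lborel T \<le> emeasure lborel (\<Union>n. B n)"
    by (intro emeasure_mono T_sub sets.countable_UN) (auto simp: B_def)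
  also have "\<dots> \<le> (\<Sum>n. emeasure lborel (B n))"
    by (intro emeasure_subadditive_countably) (auto simp: B_def)
  also have "\<dots> = ennreal ((5 * L) ^ DIM('a)) * emeasure lborel (\<Union>n. A n)"
    by (simp add: BA ennreal_suminf_cmult sumA)
  also have "\<dots> \<le> ennreal ((5 * L) ^ DIM('a)) * emeasure lborel S"
    using \<open>(\<Union>n. A n) \<subseteq> S\<close> S by (intro mult_left_mono emeasure_mono) auto
  finally show ?thesis .
qed

text \<open>\<open>C_times\<close> gives continuity of the derivative in each fixed direction.
  Summing over a basis yields a continuous bound for its operator norm, and the mean value
  inequality applies on a convex ball.\<close>

lemma C1_locally_Lipschitz:
  fixes f :: "'a::euclidean_space \<Rightarrow> 'b::euclidean_space"
  assumes f: "C_times (Suc 0) f"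
  obtains e L where "0 < e" "0 < L"
    "\<And>x y. x \<in> ball a e \<Longrightarrow> y \<in> ball a e \<Longrightarrow> norm (f x - f y) \<le> L * norm (x - y)"
proof -
  let ?D = "\<lambda>x. frechet_derivative f (at x)"
  define B where "B x = (\<Sum>b\<in>Basis. norm (?D x b))" for x
  have cont: "continuous_on UNIV B"
    unfolding B_def using f by (intro continuous_intros) auto
  have der: "(f has_derivative ?D x) (at x)" for x
    using f by (simp add: frechet_derivative_works[symmetric])
  have "open {x. B x < B a + 1}"
    by (intro open_Collect_less cont continuous_intros)
  then obtain e where e: "0 < e" "ball a e \<subseteq> {x. B x < B a + 1}"
    by (metis (mono_tags, lifting) less_add_one mem_Collect_eq openE)
  have on: "onorm (?D x) \<le> B a + 1" if x: "x \<in> ball a e" for x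
  proof (rule onorm_le)
    fix w
    have lin: "linear (?D x)" using der has_derivative_linear by blast
    have "?D x w = ?D x (\<Sum>b\<in>Basis. (w \<bullet> b) *\<^sub>R b)"
      by (simp add: euclidean_representation)
    also have "\<dots> = (\<Sum>b\<in>Basis. (w \<bullet> b) *\<^sub>R ?D x b)"
      by (simp add: linear_sum[OF lin] linear_scale[OF lin])
    also have "norm \<dots> \<le> (\<Sum>b\<in>Basis. norm (?D x b) * norm w)"
      by (intro sum_norm_le) (metis Basis_le_norm mult.commute mult_right_mono norm_ge_zero norm_scaleR)
    also have "\<dots> = B x * norm w"
      by (simp add: B_def sum_distrib_right)
    also have "\<dots> \<le> (B a + 1) * norm w"
      using e x by (intro mult_right_mono) auto
    finally show "norm (?D x w) \<le> (B a + 1) * norm w" .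
  qed
  have "0 \<le> B a" by (simp add: B_def sum_nonneg)
  then have "0 < B a + 1" by simp
  moreover have "norm (f x - f y) \<le> (B a + 1) * norm (x - y)" if "x \<in> ball a e" "y \<in> ball a e" for x y
    by (rule differentiable_bound[OF convex_ball has_derivative_at_withinI[OF der] on that])
  ultimately show thesis
    using that e(1) by blast
qed

lemma sigma_finite_lebesgue: "sigma_finite_measure (lebesgue :: 'a::euclidean_space measure)"
proof -
  obtain A :: "'a set set" where A: "countable A" "A \<subseteq> sets lborel" "\<Union>A = space lborel"
    "\<forall>a\<in>A. emeasure lborel a \<noteq> \<infinity>"
    using lborel.sigma_finite_countable by (elim exE conjE) (rule that)
  show ?thesis
  proof
    show "\<exists>A :: 'a set set. countable A \<and> A \<subseteq> sets lebesgue \<and> \<Union>A = space lebesgue \<and> (\<forall>a\<in>A. emeasure lebesgue a \<noteq> \<infinity>)"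
    proof (intro exI[of _ A] conjI ballI)
      show "A \<subseteq> sets lebesgue" using A(2) by auto
      show "\<Union>A = space lebesgue" using A(3) by simp
      show "emeasure lebesgue a \<noteq> \<infinity>" if "a \<in> A" for a
        using bspec[OF A(4) that] subsetD[OF A(2) that] by simp
    qed (rule A(1))
  qed
qed

section \<open>Anisotropic dilations and Lebesgue measure\<close>

text \<open>This is the diagonal form expected by \<open>lborel_affine_euclidean\<close>; at the
  i-th basis vector the inner sum picks out \<open>r powr \<nu> i\<close>.\<close>

lemma dilation_eq_sum_Basis:
  "dilation \<nu> r x = (\<Sum>j\<in>Basis. ((\<Sum>i\<in>UNIV. r powr \<nu> i * j $ i) * (x \<bullet> j)) *\<^sub>R j)"
proof -
  define c where "c j = (\<Sum>i\<in>UNIV. r powr \<nu> i * j $ i)" for j :: "real ^ 'a"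
  define v where "v = (\<Sum>j\<in>Basis. (c j * (x \<bullet> j)) *\<^sub>R j)"
  have "dilation \<nu> r x $ i = v $ i" for i
  proof -
    have "c (axis i 1) = r powr \<nu> i"
      unfolding c_def by (subst sum.remove[of _ i]) (auto simp: axis_def)
    moreover have "v \<bullet> axis i 1 = c (axis i 1) * (x \<bullet> axis i 1)"
      unfolding v_def by (rule inner_sum_left_Basis) (auto simp: Basis_vec_def)
    ultimately show ?thesis
      by (simp add: dilation_def inner_axis)
  qed
  then show ?thesis
    by (simp add: vec_eq_iff v_def c_def)
qed

lemma dilation_dilation: "0 < r \<Longrightarrow> 0 < s \<Longrightarrow> dilation \<nu> r (dilation \<nu> s x) = dilation \<nu> (r * s) x"
  by (simp add: dilation_def vec_eq_iff powr_mult)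

lemma dilation_1: "dilation \<nu> 1 x = x"
  by (simp add: dilation_def vec_eq_iff)

lemma continuous_on_dilation: "continuous_on UNIV (dilation \<nu> r)"
  unfolding dilation_def by (intro continuous_intros)

lemma dilation_image_eq_vimage:
  assumes "0 < r" shows "dilation \<nu> r ` S = dilation \<nu> (1 / r) -` S"
proof (rule Set.set_eqI, rule iffI)
  fix x assume "x \<in> dilation \<nu> (1 / r) -` S"
  moreover have "x = dilation \<nu> r (dilation \<nu> (1 / r) x)"
    using assms by (simp add: dilation_dilation dilation_1)
  ultimately show "x \<in> dilation \<nu> r ` S" by blast
qed (use assms in \<open>auto simp: dilation_dilation dilation_1\<close>)

lemma open_dilation_image: "0 < r \<Longrightarrow> open S \<Longrightarrow> open (dilation \<nu> r ` S)"
  by (simp add: dilation_image_eq_vimage continuous_on_dilation open_vimage)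

text \<open>A dilation is linear and diagonal, with determinant the product of all
  \<open>r powr \<nu> i\<close>.\<close>

lemma emeasure_dilation_image:
  fixes S :: "(real ^ 'n) set"
  assumes r: "0 < r" and S: "open S"
  shows "emeasure lborel (dilation \<nu> r ` S) = ennreal (r powr homogeneous_dimension \<nu>) * emeasure lborel S"
proof -
  define c where "c j = (\<Sum>i\<in>UNIV. r powr \<nu> i * j $ i)" for j :: "real ^ 'n"
  have c_axis: "c (axis i 1) = r powr \<nu> i" for i
    unfolding c_def by (subst sum.remove[of _ i]) (auto simp: axis_def)
  have basis: "(Basis :: (real ^ 'n) set) = (\<lambda>i. axis i 1) ` UNIV"
    by (auto simp: Basis_vec_def)
  have "(\<Prod>j\<in>Basis. \<bar>c j\<bar>) = (\<Prod>i\<in>UNIV. r powr \<nu> i)"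
    unfolding basis by (subst prod.reindex) (auto simp: inj_on_def axis_eq_axis c_axis)
  also have "\<dots> = r powr homogeneous_dimension \<nu>"
    using r by (simp add: homogeneous_dimension_def powr_sum)
  finally have P: "(\<Prod>j\<in>Basis. \<bar>c j\<bar>) = r powr homogeneous_dimension \<nu>" .
  have eq: "(\<lambda>x. 0 + (\<Sum>j\<in>Basis. (c j * (x \<bullet> j)) *\<^sub>R j)) = dilation \<nu> r"
    by (simp add: fun_eq_iff dilation_eq_sum_Basis c_def)
  \<comment> \<open>Lebesgue measure as a multiple of its pushforward: evaluated at the image of
    \<open>S\<close>, it gives the factor times the measure of the preimage, which is
    \<open>S\<close>.\<close>
  have lb: "lborel = density (distr lborel borel (dilation \<nu> r)) (\<lambda>_. r powr homogeneous_dimension \<nu>)"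
    by (rule lborel_affine_euclidean[of c 0, unfolded eq P]) (use r in \<open>auto simp: basis c_axis\<close>)
  have [measurable]: "dilation \<nu> r \<in> borel_measurable borel"
    by (intro borel_measurable_continuous_onI continuous_on_dilation)
  have op: "open (dilation \<nu> r ` S)" using r S by (rule open_dilation_image)
  then have "emeasure lborel (dilation \<nu> r ` S)
      = ennreal (r powr homogeneous_dimension \<nu>) * emeasure lborel (dilation \<nu> r -` (dilation \<nu> r ` S))"
    by (subst lb) (simp add: emeasure_density nn_integral_cmult_indicator emeasure_distr)
  also have "dilation \<nu> r -` (dilation \<nu> r ` S) = S"
    using r by (auto simp: dilation_image_eq_vimage dilation_dilation dilation_1)
  finally show ?thesis .
qed

lemma norm_dilation_le: "norm (dilation \<nu> r x) \<le> (\<Sum>i\<in>UNIV. r powr \<nu> i) * norm x"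
proof -
  have "norm (dilation \<nu> r x) \<le> (\<Sum>i\<in>UNIV. \<bar>dilation \<nu> r x $ i\<bar>)"
    by (rule norm_le_l1_cart)
  also have "\<dots> \<le> (\<Sum>i\<in>UNIV. r powr \<nu> i * norm x)"
    by (intro sum_mono) (simp add: dilation_def abs_mult component_le_norm_cart mult_left_mono)
  finally show ?thesis by (simp add: sum_distrib_right)
qed

text \<open>Since the weights are positive, the factor in \<open>norm_dilation_le\<close> tends to
  0, uniformly over a bounded set of points.\<close>

lemma eventually_norm_dilation_less:
  fixes \<nu> :: "'n::finite \<Rightarrow> real"
  assumes \<nu>: "\<And>i. 0 < \<nu> i" and e: "0 < e"
  shows "\<forall>\<^sub>F r in at_right 0. \<forall>x. norm x \<le> B \<longrightarrow> norm (dilation \<nu> r x) < e"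
proof -
  have "\<forall>\<^sub>F r :: real in at_right 0. 0 \<le> r"
    using eventually_at_right_less by (rule eventually_mono) simp
  then have "((\<lambda>r. r powr \<nu> i) \<longlongrightarrow> 0) (at_right 0)" for i
    by (intro tendsto_zero_powrI[where b="\<nu> i"] tendsto_ident_at tendsto_const \<nu>)
  then have "((\<lambda>r. \<Sum>i\<in>UNIV. r powr \<nu> i) \<longlongrightarrow> (\<Sum>i\<in>(UNIV :: 'n set). 0)) (at_right 0)"
    by (intro tendsto_sum)
  then have "((\<lambda>r. (\<Sum>i\<in>UNIV. r powr \<nu> i) * \<bar>B\<bar>) \<longlongrightarrow> (\<Sum>i\<in>(UNIV :: 'n set). 0) * \<bar>B\<bar>) (at_right 0)"
    by (rule tendsto_mult_right)
  then have "\<forall>\<^sub>F r in at_right 0. (\<Sum>i\<in>UNIV. r powr \<nu> i) * \<bar>B\<bar> < e"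
    by (rule order_tendstoD) (use e in auto)
  then show ?thesis
  proof eventually_elim
    case (elim r)
    show ?case
    proof (intro allI impI)
      fix x :: "real ^ 'n" assume "norm x \<le> B"
      have "norm (dilation \<nu> r x) \<le> (\<Sum>i\<in>UNIV. r powr \<nu> i) * norm x"
        by (rule norm_dilation_le)
      also have "\<dots> \<le> (\<Sum>i\<in>UNIV. r powr \<nu> i) * \<bar>B\<bar>"
        using \<open>norm x \<le> B\<close> by (intro mult_left_mono sum_nonneg) auto
      also note elim
      finally show "norm (dilation \<nu> r x) < e" .
    qed
  qed
qed

section \<open>Volume growth of homogeneous groups\<close>

lemma (in homogeneous_group) dilation_mult:
  "0 < r \<Longrightarrow> dilation \<nu> r (x \<otimes> y) = dilation \<nu> r x \<otimes> dilation \<nu> r y"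
  using dilation_iso[of r] by (auto simp: iso_def hom_def carrier_UNIV)

lemma (in homogeneous_group) continuous_on_mult:
  assumes "continuous_on S f" "continuous_on S g"
  shows "continuous_on S (\<lambda>x. f x \<otimes> g x)"
proof -
  have "continuous_on UNIV (\<lambda>(x, y). x \<otimes> y)"
    using smooth_mult by (metis C_times.simps(1) smooth_def)
  then have "continuous_on S ((\<lambda>(x, y). x \<otimes> y) \<circ> (\<lambda>x. (f x, g x)))"
    by (intro continuous_on_compose continuous_on_Pair assms) (auto intro: continuous_on_subset)
  then show ?thesis by (simp add: comp_def)
qed

lemma (in homogeneous_group) continuous_on_inv: "continuous_on UNIV (\<lambda>x. inv x)"
  using smooth_inv by (metis C_times.simps(1) smooth_def)

text \<open>The product is smooth jointly in both variables, hence Lipschitz near (0, 0); fixing the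
  first coordinate gives a constant independent of \<open>z\<close>.\<close>

lemma (in homogeneous_group) left_translation_Lipschitz:
  obtains e L where "0 < e" "0 < L"
    "\<And>z x y. norm z < e \<Longrightarrow> norm x < e \<Longrightarrow> norm y < e \<Longrightarrow> dist (z \<otimes> x) (z \<otimes> y) \<le> L * dist x y"
proof -
  let ?f = "\<lambda>(x, y). x \<otimes> y"
  have "C_times (Suc 0) ?f"
    using smooth_mult unfolding smooth_def by blast
  then obtain e L where e: "0 < e" "0 < L"
    and lip: "\<And>p q. p \<in> ball 0 e \<Longrightarrow> q \<in> ball 0 e \<Longrightarrow> norm (?f p - ?f q) \<le> L * norm (p - q)"
    using C1_locally_Lipschitz[of ?f 0] by blast
  show thesis
  proof (rule that[of "e / 2" L])
    fix z x y :: "real ^ 'n" assume zxy: "norm z < e / 2" "norm x < e / 2" "norm y < e / 2"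
    have "(z, x) \<in> ball 0 e" "(z, y) \<in> ball 0 e"
      using zxy norm_Pair_le[of z x] norm_Pair_le[of z y] by auto
    from lip[OF this] show "dist (z \<otimes> x) (z \<otimes> y) \<le> L * dist x y"
      by (simp add: dist_norm norm_Pair)
  qed (use e in auto)
qed

text \<open>By compactness \<open>qnorm\<close> has a positive minimum on the Euclidean unit sphere.
  A point outside the unit ball reaches the sphere under a dilation with factor at most 1, which
  does not increase \<open>qnorm\<close>.\<close>

lemma (in homogeneous_quasi_norm) qnorm_ball_subset_cball:
  obtains c where "0 < c" "{x. qnorm x < c} \<subseteq> cball 0 1"
proof -
  have "axis undefined 1 \<in> sphere (0 :: real ^ 'n) 1" by simp
  then obtain x0 where x0: "x0 \<in> sphere 0 1" "\<And>x. x \<in> sphere 0 1 \<Longrightarrow> qnorm x0 \<le> qnorm x"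
    using continuous_attains_inf[of "sphere (0 :: real ^ 'n) 1" qnorm]
      continuous_on_subset[OF qnorm_continuous] by (metis compact_sphere empty_iff top_greatest)
  have "x0 \<noteq> 0" using x0 by auto
  then have c: "0 < qnorm x0"
    using qnorm_nonneg[of x0] qnorm_eq_0_iff[of x0] by linarith
  have "norm x \<le> 1" if x: "qnorm x < qnorm x0" for x
  proof (rule ccontr)
    assume "\<not> norm x \<le> 1"
    then have n: "1 < norm x" by simp
    have "\<forall>\<^sub>F r in at_right 0. \<forall>u. norm u \<le> norm x \<longrightarrow> norm (dilation \<nu> r u) < 1"
      using weight_pos zero_less_one by (rule eventually_norm_dilation_less)
    then obtain b where b: "0 < b" "\<And>r. 0 < r \<Longrightarrow> r < b \<Longrightarrow> norm (dilation \<nu> r x) < 1"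
      by (auto simp: eventually_at_right_field)
    define r0 where "r0 = min b 1 / 2"
    have r0: "0 < r0" "r0 < 1" "norm (dilation \<nu> r0 x) < 1"
      using b by (auto simp: r0_def min_def)
    have "continuous_on {r0..1} (\<lambda>r. norm (dilation \<nu> r x))"
      unfolding dilation_def using r0 by (intro continuous_intros) auto
    \<comment> \<open>The Euclidean norm runs from below 1 at \<open>r0\<close> to above 1 at r =
      1.\<close>
    then have "\<exists>r\<ge>r0. r \<le> 1 \<and> norm (dilation \<nu> r x) = 1"
      using r0 n by (intro IVT') (auto simp: dilation_1)
    then obtain r where r: "r0 \<le> r" "r \<le> 1" "norm (dilation \<nu> r x) = 1" by blast
    have "qnorm x0 \<le> qnorm (dilation \<nu> r x)"
      using x0(2) r(3) by simp
    also have "\<dots> = r * qnorm x" using r r0 by (simp add: qnorm_dilation)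
    also have "\<dots> \<le> qnorm x" using r r0 qnorm_nonneg[of x] by (intro mult_left_le_one_le) auto
    finally show False using x by simp
  qed
  with c show thesis by (intro that[of "qnorm x0"]) auto
qed

text \<open>A dilation by a small \<open>r\<close> carries the quasi-ball into a left translate, by
  the dilated centre, of a quasi-ball of radius r R around 0. The Lipschitz estimate bounds the
  volume there by a constant times (r R)^Q, and dividing by r^Q removes the dependence on the
  centre.\<close>

lemma (in homogeneous_quasi_norm) emeasure_quasi_ball_le:
  obtains V where "0 < V"
    "\<And>y R. 0 < R \<Longrightarrow> emeasure lborel {x. qnorm (inv y \<otimes> x) < R} \<le> ennreal (V * R powr homogeneous_dimension \<nu>)"
proof -
  let ?Q = "homogeneous_dimension \<nu>"
  obtain e L where e: "0 < e" "0 < L"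
    and lip: "\<And>z x y. norm z < e \<Longrightarrow> norm x < e \<Longrightarrow> norm y < e \<Longrightarrow> dist (z \<otimes> x) (z \<otimes> y) \<le> L * dist x y"
    by (rule left_translation_Lipschitz) blast
  obtain c where c: "0 < c" "{x. qnorm x < c} \<subseteq> cball 0 1"
    by (rule qnorm_ball_subset_cball)
  define B where "B = {x. qnorm x < c}"
  have opB: "open B"
    unfolding B_def by (intro open_Collect_less qnorm_continuous continuous_intros)
  define \<kappa> where "\<kappa> = measure lborel (cball (0 :: real ^ 'n) 1)"
  have "emeasure lborel B \<le> emeasure lborel (cball (0 :: real ^ 'n) 1)"
    using c by (intro emeasure_mono) (auto simp: B_def)
  also have "\<dots> = ennreal \<kappa>"
    unfolding \<kappa>_def using emeasure_lborel_cball_finite[of "0 :: real ^ 'n" 1]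
    by (intro emeasure_eq_ennreal_measure) auto
  finally have B\<kappa>: "emeasure lborel B \<le> ennreal \<kappa>" .
  \<comment> \<open>The product is the constant produced by the estimate; the summand 1 makes
    \<open>V\<close> positive.\<close>
  define V where "V = (5 * L) ^ DIM(real ^ 'n) * \<kappa> * (1 / c) powr ?Q + 1"
  have "0 \<le> \<kappa>" by (simp add: \<kappa>_def)
  show thesis
  proof (rule that[of V])
    show "0 < V" using e c \<open>0 \<le> \<kappa>\<close> by (simp add: V_def add_nonneg_pos)
    fix y :: "real ^ 'n" and R :: real assume R: "0 < R"
    define E where "E = {x. qnorm (inv y \<otimes> x) < R}"
    have "continuous_on UNIV (\<lambda>x. qnorm (inv y \<otimes> x))"
      by (rule continuous_on_compose2[OF qnorm_continuous]) (auto intro!: continuous_on_mult continuous_intros)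
    then have opE: "open E"
      unfolding E_def by (intro open_Collect_less continuous_intros)
    have "\<forall>\<^sub>F s in at_right 0. \<forall>x::real^'n. norm x \<le> 1 \<longrightarrow> norm (dilation \<nu> s x) < e"
      using weight_pos e(1) by (rule eventually_norm_dilation_less)
    then obtain s0 where s0: "0 < s0" "\<And>s x::real^'n. 0 < s \<Longrightarrow> s < s0 \<Longrightarrow> norm x \<le> 1 \<Longrightarrow> norm (dilation \<nu> s x) < e"
      by (auto simp: eventually_at_right_field)
    have "\<forall>\<^sub>F r in at_right 0. \<forall>x. norm x \<le> norm y \<longrightarrow> norm (dilation \<nu> r x) < e"
      using weight_pos e(1) by (rule eventually_norm_dilation_less)
    then obtain r0 where r0: "0 < r0" "\<And>r. 0 < r \<Longrightarrow> r < r0 \<Longrightarrow> norm (dilation \<nu> r y) < e"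
      by (auto simp: eventually_at_right_field)
    \<comment> \<open>Shrinking by \<open>r\<close> moves the centre and the quasi-ball into the region where \<open>lip\<close> applies.\<close>
    define t where "t = s0 * c / R"
    define r where "r = min r0 t / 2"
    have "0 < t" using s0(1) c(1) R by (simp add: t_def)
    then have r: "0 < r" "r < r0" "r < t"
      using r0(1) by (auto simp: r_def min_def)
    \<comment> \<open>Dilating \<open>B\<close> by \<open>s\<close> gives the quasi-ball of radius s
      c = r R around 0; the condition r < t amounts to s < s0.\<close>
    define s where "s = r * R / c"
    have s: "0 < s" "s < s0" using r R c by (auto simp: s_def t_def field_simps)
    have sub: "dilation \<nu> r ` E \<subseteq> (\<lambda>u. dilation \<nu> r y \<otimes> u) ` (dilation \<nu> s ` B)"
    proof
      fix x' assume "x' \<in> dilation \<nu> r ` E"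
      then obtain x where x: "x' = dilation \<nu> r x" "qnorm (inv y \<otimes> x) < R" by (auto simp: E_def)
      define w where "w = inv y \<otimes> x"
      have "x = y \<otimes> w"
        unfolding w_def by (simp add: m_assoc[symmetric] carrier_UNIV)
      then have x': "x' = dilation \<nu> r y \<otimes> dilation \<nu> r w"
        using r x by (simp add: dilation_mult)
      have "dilation \<nu> r w = dilation \<nu> s (dilation \<nu> (c / R) w)"
        using s c R by (simp add: dilation_dilation) (simp add: s_def)
      moreover have "dilation \<nu> (c / R) w \<in> B"
        using x(2) c R by (simp add: B_def qnorm_dilation w_def[symmetric] field_simps)
      ultimately show "x' \<in> (\<lambda>u. dilation \<nu> r y \<otimes> u) ` (dilation \<nu> s ` B)"
        using x' by auto
    qed
    have small: "norm u < e" if "u \<in> dilation \<nu> s ` B" for u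
      using that s0(2)[OF s] c(2) by (auto simp: B_def)
    have "ennreal (r powr ?Q) * emeasure lborel E = emeasure lborel (dilation \<nu> r ` E)"
      using r opE by (simp add: emeasure_dilation_image)
    also have "\<dots> \<le> ennreal ((5 * L) ^ DIM(real ^ 'n)) * emeasure lborel (dilation \<nu> s ` B)"
      by (rule emeasure_subset_Lipschitz_image_le[OF open_dilation_image[OF s(1) opB] e(2) _ sub])
        (intro lip r0(2) r small)
    also have "\<dots> = ennreal ((5 * L) ^ DIM(real ^ 'n)) * (ennreal (s powr ?Q) * emeasure lborel B)"
      using s opB by (simp add: emeasure_dilation_image)
    also have "\<dots> \<le> ennreal ((5 * L) ^ DIM(real ^ 'n)) * (ennreal (s powr ?Q) * ennreal \<kappa>)"
      by (intro mult_left_mono B\<kappa>) auto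
    also have "\<dots> = ennreal ((5 * L) ^ DIM(real ^ 'n) * (s powr ?Q * \<kappa>))"
      using e \<open>0 \<le> \<kappa>\<close> by (simp only: ennreal_mult[symmetric] mult_nonneg_nonneg powr_ge_zero zero_le_power)
    also have "\<dots> \<le> ennreal (r powr ?Q * (V * R powr ?Q))"
      using r R c by (intro ennreal_leI) (simp add: s_def V_def powr_mult powr_divide algebra_simps)
    finally have "ennreal (1 / r powr ?Q) * (ennreal (r powr ?Q) * emeasure lborel E)
        \<le> ennreal (1 / r powr ?Q) * ennreal (r powr ?Q * (V * R powr ?Q))"
      by (rule mult_left_mono) simp
    then show "emeasure lborel {x. qnorm (inv y \<otimes> x) < R} \<le> ennreal (V * R powr ?Q)"
      using r \<open>0 < V\<close> by (simp add: E_def mult.assoc[symmetric] flip: ennreal_mult)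
  qed
qed

section \<open>From the abstract kernel inequality to homogeneous groups\<close>

lemma (in homogeneous_group) homogeneous_dimension_pos: "0 < homogeneous_dimension \<nu>"
  unfolding homogeneous_dimension_def by (intro sum_pos weight_pos) auto

lemma (in homogeneous_quasi_norm) qnorm_volume_growth:
  obtains V where "volume_growth lebesgue (\<lambda>y x. qnorm (inv y \<otimes> x)) V (homogeneous_dimension \<nu>)"
proof -
  let ?N = "\<lambda>y x. qnorm (inv y \<otimes> x)"
  obtain V where V: "0 < V" "\<And>y R. 0 < R \<Longrightarrow>
      emeasure lborel {x. ?N y x < R} \<le> ennreal (V * R powr homogeneous_dimension \<nu>)"
    by (rule emeasure_quasi_ball_le) blast
  have cont: "continuous_on UNIV (\<lambda>p. ?N (fst p) (snd p))"
    by (rule continuous_on_compose2[OF qnorm_continuous])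
      (auto intro!: continuous_on_mult continuous_intros continuous_on_compose2[OF continuous_on_inv])
  then have "(\<lambda>p. ?N (fst p) (snd p)) \<in> borel_measurable (borel \<Otimes>\<^sub>M borel)"
    unfolding borel_prod by (rule borel_measurable_continuous_onI)
  \<comment> \<open>Borel measurability is pulled back along the identity, because the kernel must
    be measurable for the product of the completed measures.\<close>
  moreover have "(\<lambda>p. (fst p, snd p)) \<in> (lebesgue \<Otimes>\<^sub>M lebesgue) \<rightarrow>\<^sub>M
      (borel \<Otimes>\<^sub>M borel :: ((real ^ 'n) \<times> (real ^ 'n)) measure)"
    by (intro measurable_Pair measurable_compose[OF measurable_fst] measurable_compose[OF measurable_snd] measurable_completion) auto
  ultimately have meas: "(\<lambda>(y, x). ?N y x) \<in> borel_measurable (lebesgue \<Otimes>\<^sub>M lebesgue)"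
    using measurable_compose by (fastforce simp: case_prod_beta)
  have "open {x. ?N y x < R}" for y R
    by (intro open_Collect_less continuous_intros continuous_on_compose2[OF qnorm_continuous] continuous_on_mult) auto
  then have ball: "emeasure lebesgue {x. ?N y x < R} \<le> ennreal (V * R powr homogeneous_dimension \<nu>)"
    if "0 < R" for y R
    using V(2)[OF that, of y] by simp
  have sym: "?N y x = ?N x y" for x y
  proof -
    \<comment> \<open>The two values of the kernel are quasi-norms of mutually inverse
      elements.\<close>
    have "inv (inv x \<otimes> y) = inv y \<otimes> x"
      by (subst inv_mult_group) (auto simp: carrier_UNIV)
    then show ?thesis
      using qnorm_inv[of "inv x \<otimes> y"] by metis
  qed
  interpret sigma_finite_measure "lebesgue :: (real ^ 'n) measure"
    by (rule sigma_finite_lebesgue)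
  show thesis
  proof (rule that[of V], unfold_locales)
    show "0 < V" "0 < homogeneous_dimension \<nu>"
      by (rule V homogeneous_dimension_pos)+
    show "0 \<le> ?N x y" for x y by (rule qnorm_nonneg)
    show "?N x y = ?N y x" for x y by (rule sym)
    show "(\<lambda>(y, x). ?N y x) \<in> borel_measurable (lebesgue \<Otimes>\<^sub>M lebesgue)" by (rule meas)
    show "emeasure lebesgue {x \<in> space lebesgue. ?N y x < R} \<le> ennreal (V * R powr homogeneous_dimension \<nu>)"
      if "0 < R" for y R
      using ball[OF that, of y] by simp
  qed
qed

text \<open>The double integral takes values in the extended nonnegative reals, so the case of
  divergence is included.\<close>

theorem corollary2p6:
  fixes G :: "(real ^ 'n) monoid" and \<nu> :: "'n \<Rightarrow> real" and qnorm :: "real ^ 'n \<Rightarrow> real"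
    and Q l p q' :: real
  assumes "homogeneous_group G \<nu>"
    and "Q = homogeneous_dimension \<nu>" and "Q \<ge> 1"
    and "homogeneous_quasi_norm G \<nu> qnorm"
    and "l > 0" and "0 < p" and "p < 1" and "0 < q'" and "q' < 1"
    and "1 / q' + 1 / p = l / Q + 2"
  shows "\<exists>C>0. \<forall>f h. f \<in> Lspace q' \<longrightarrow> h \<in> Lspace p \<longrightarrow> (\<forall>x. 0 \<le> f x) \<longrightarrow> (\<forall>x. 0 \<le> h x) \<longrightarrow>
    (\<integral>\<^sup>+ y. (\<integral>\<^sup>+ x. ennreal (qnorm (inv\<^bsub>G\<^esub> y \<otimes>\<^bsub>G\<^esub> x) powr l * f x * h y) \<partial>lebesgue) \<partial>lebesgue)
      \<ge> ennreal (C * Lnorm q' f * Lnorm p h)"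
proof -
  interpret homogeneous_quasi_norm G \<nu> qnorm by fact
  obtain V where "volume_growth lebesgue (\<lambda>y x. qnorm (inv\<^bsub>G\<^esub> y \<otimes>\<^bsub>G\<^esub> x)) V Q"
    using qnorm_volume_growth assms(2) by blast
  then interpret volume_growth lebesgue "\<lambda>y x. qnorm (inv\<^bsub>G\<^esub> y \<otimes>\<^bsub>G\<^esub> x)" V Q .
  obtain C where "0 < C" and C: "\<forall>f h. f \<in> borel_measurable lebesgue \<longrightarrow> h \<in> borel_measurable lebesgue \<longrightarrow>
      (\<forall>x. 0 \<le> f x) \<longrightarrow> (\<forall>x. 0 \<le> h x) \<longrightarrow>
      integrable lebesgue (\<lambda>x. f x powr q') \<longrightarrow> integrable lebesgue (\<lambda>x. h x powr p) \<longrightarrow>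
      ennreal (C * (LINT x|lebesgue. f x powr q') powr (1 / q') * (LINT x|lebesgue. h x powr p) powr (1 / p))
      \<le> (\<integral>\<^sup>+ y. (\<integral>\<^sup>+ x. ennreal (qnorm (inv\<^bsub>G\<^esub> y \<otimes>\<^bsub>G\<^esub> x) powr l * f x * h y) \<partial>lebesgue) \<partial>lebesgue)"
    using reverse_HLS[OF assms(8,9,6,7,10)] by blast
  show ?thesis
  proof (intro exI[of _ C] conjI allI impI \<open>0 < C\<close>)
    fix f h :: "real ^ 'n \<Rightarrow> real"
    assume f: "f \<in> Lspace q'" "\<forall>x. 0 \<le> f x" and h: "h \<in> Lspace p" "\<forall>x. 0 \<le> h x"
    then have "f \<in> borel_measurable lebesgue" "integrable lebesgue (\<lambda>x. f x powr q')"
      and "h \<in> borel_measurable lebesgue" "integrable lebesgue (\<lambda>x. h x powr p)"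
      by (auto simp: Lspace_def)
    note le = C[rule_format, OF this(1,3) spec[OF f(2)] spec[OF h(2)] this(2,4)]
    have norms: "Lnorm q' f = (LINT x|lebesgue. f x powr q') powr (1 / q')"
      "Lnorm p h = (LINT x|lebesgue. h x powr p) powr (1 / p)"
      using f(2) h(2) by (auto simp: Lnorm_def)
    show "ennreal (C * Lnorm q' f * Lnorm p h)
        \<le> (\<integral>\<^sup>+ y. (\<integral>\<^sup>+ x. ennreal (qnorm (inv\<^bsub>G\<^esub> y \<otimes>\<^bsub>G\<^esub> x) powr l * f x * h y) \<partial>lebesgue) \<partial>lebesgue)"
      unfolding norms by (rule le)
  qed
qed

end
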